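(* Let $a\in(0,1)$ and let $k\in\{2n+1 : n\in\mathbb{N}_0\}$ be an odd positive integer. Let $$h_{a,k}(x)=\psi^{(k)}(x+a)-\psi^{(k)}(x)-\frac{a\,k!}{x^{k+1}}.$$ Then $-h_{a,k}(x)$ is strictly completely monotonic on $(0,\infty)$.
   Context: $\mathbb{N}_0=\{0,1,2,\dots\}$. $\Gamma$ is the classical Gamma function, $\psi(x)=\frac{d}{dx}\ln\Gamma(x)$ for $x>0$ is the digamma function, and $\psi^{(k)}$ is its $k$-th derivative (polygamma function). A function $f:(0,\infty)\to\mathbb{R}$ is completely monotonic on $(0,\infty)$ if it has derivatives of all orders and $(-1)^n f^{(n)}(x)\ge 0$ for all $x\in(0,\infty)$ and all $n\in\mathbb{N}_0$; it is strictly completely monotonic if these inequalities are strict, i.e. $(-1)^n f^{(n)}(x)>0$ for all $x\in(0,\infty)$ and all $n\in\mathbb{N}_0$. *)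

theory Defs
  imports "HOL-Analysis.Analysis"
begin

text \<open>Only the values of \<open>f\<close> on the open half-line \<open>{0<..}\<close> matter here, since
  \<open>(deriv ^^ n) f x\<close> depends only on \<open>f\<close> near \<open>x\<close>. The differentiability conjunct is needed
  because \<open>deriv\<close> is total.\<close>

definition strictly_completely_monotonic :: "(real \<Rightarrow> real) \<Rightarrow> bool" where
  "strictly_completely_monotonic f \<longleftrightarrow>
     (\<forall>n. \<forall>x>0. (deriv ^^ n) f differentiable (at x)) \<and>
     (\<forall>n. \<forall>x>0. (- 1) ^ n * (deriv ^^ n) f x > 0)"

text \<open>The library defines \<^const>\<open>Polygamma\<close> by series; on the positive reals it is the
  iterated derivative of the digamma function \<open>(ln \<circ> Gamma)'\<close>.\<close>

lemma Polygamma_eq_higher_deriv_ln_Gamma: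
  fixes x :: real
  assumes "x > 0"
  shows "Polygamma k x = (deriv ^^ k) (deriv (\<lambda>t. ln (Gamma t))) x"
proof -
  have "eventually (\<lambda>t. t > (0::real)) (nhds x)"
    using assms by (intro eventually_nhds_in_open[of "{0<..}" x, simplified]) auto
  then have ev: "eventually (\<lambda>t. ln (Gamma t) = ln_Gamma t) (nhds x)"
    by eventually_elim (simp add: ln_Gamma_real_pos)
  have "(deriv ^^ Suc k) (\<lambda>t. ln (Gamma t)) x = (deriv ^^ Suc k) ln_Gamma x"
    by (intro higher_deriv_cong_ev ev refl)
  also have "\<dots> = Polygamma k x"
    using higher_deriv_ln_Gamma_real[OF assms, of "Suc k"] by simp
  finally show ?thesis
    by (simp add: funpow_Suc_right del: funpow.simps)
qed

definition h :: "real \<Rightarrow> nat \<Rightarrow> real \<Rightarrow> real" where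
  "h a k x = Polygamma k (x + a) - Polygamma k x - a * fact k / x ^ (k + 1)"

end

theory Submission
  imports Defs
begin

text \<open>
  Each signed derivative \<open>(-1)^n (-h)^(n)\<close> is a sum of two positive terms: for odd \<open>k\<close> the function
  \<open>(-1)^n Polygamma (k + n)\<close> is strictly decreasing, and the iterated derivatives of
  \<open>1 / x^(k + 1)\<close> alternate in sign.
\<close>

lemma has_field_derivative_divide_power:
  fixes x c :: real
  assumes "x \<noteq> 0"
  shows "((\<lambda>x. c / x ^ Suc m) has_field_derivative - c * real (Suc m) / x ^ Suc (Suc m)) (at x)"
proof -
  have "((\<lambda>x. c / x ^ Suc m) has_field_derivative
      - (c * (real (Suc m) * x ^ m)) / (x ^ Suc m * x ^ Suc m)) (at x)"
    using assms DERIV_divide[OF DERIV_const DERIV_pow, of x "Suc m" c] by simp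
  then show ?thesis
    using assms by (simp add: divide_simps)
qed

text \<open>Explicit candidate for the \<open>n\<close>-th derivative of \<open>- h a k\<close> on
  the positive reals; the last summand is the \<open>n\<close>-th derivative of
  \<open>a * fact k / x ^ (k + 1)\<close>.\<close>

definition uminus_h_deriv :: "real \<Rightarrow> nat \<Rightarrow> nat \<Rightarrow> real \<Rightarrow> real" where
  "uminus_h_deriv a k n x = Polygamma (k + n) x - Polygamma (k + n) (x + a)
     + a * ((- 1) ^ n * fact (k + n)) / x ^ Suc (k + n)"

lemma has_field_derivative_uminus_h_deriv:
  assumes "a > 0" "x > 0"
  shows "(uminus_h_deriv a k n has_field_derivative uminus_h_deriv a k (Suc n) x) (at x)"
proof -
  have "((\<lambda>x. a * ((- 1) ^ n * fact (k + n)) / x ^ Suc (k + n)) has_field_derivative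
      a * ((- 1) ^ Suc n * fact (k + Suc n)) / x ^ Suc (k + Suc n)) (at x)"
    \<comment> \<open>The new factor \<open>- (k + n + 1)\<close> flips the sign and extends
      \<open>fact (k + n)\<close> to \<open>fact (k + Suc n)\<close>.\<close>
    using has_field_derivative_divide_power[of x "a * ((- 1) ^ n * fact (k + n))" "k + n"] assms(2)
    by (simp add: algebra_simps)
  moreover have "((\<lambda>x. Polygamma (k + n) x - Polygamma (k + n) (x + a)) has_field_derivative
      Polygamma (k + Suc n) x - Polygamma (k + Suc n) (x + a)) (at x)"
    \<comment> \<open>\<open>Polygamma\<close> is differentiable away from the nonpositive integers,
      and both \<open>x\<close> and \<open>x + a\<close> are positive.\<close>
    using assms by (auto intro!: derivative_eq_intros elim!: nonpos_Ints_cases)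
  ultimately show ?thesis
    unfolding uminus_h_deriv_def [abs_def] by (rule DERIV_add[rotated])
qed

text \<open>Induction on \<open>n\<close>. Equality at a single point would not determine the next
  derivative, so agreement on a neighbourhood is carried along, with the base point
  arbitrary.\<close>

lemma eventually_higher_deriv_uminus_h:
  assumes "a > 0" "x > 0"
  shows "eventually (\<lambda>y. (deriv ^^ n) (\<lambda>x. - h a k x) y = uminus_h_deriv a k n y) (nhds x)"
  using assms(2)
proof (induction n arbitrary: x)
  case 0
  show ?case by (simp add: h_def uminus_h_deriv_def)
next
  case (Suc n)
  have "eventually (\<lambda>y. y \<in> {0<..}) (nhds x)"
    using Suc.prems by (intro eventually_nhds_in_open) auto
  then show ?case
  proof eventually_elim
    case (elim y)
    then have "deriv ((deriv ^^ n) (\<lambda>x. - h a k x)) y = deriv (uminus_h_deriv a k n) y"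
      by (intro deriv_cong_ev Suc.IH) auto
    then show ?case
      using elim has_field_derivative_uminus_h_deriv[OF assms(1)] by (simp add: DERIV_imp_deriv)
  qed
qed

lemma higher_deriv_uminus_h:
  assumes "a > 0" "x > 0"
  shows "(deriv ^^ n) (\<lambda>x. - h a k x) x = uminus_h_deriv a k n x"
  using eventually_higher_deriv_uminus_h[OF assms] by (rule eventually_nhds_x_imp_x)

lemma has_field_derivative_higher_deriv_uminus_h:
  assumes "a > 0" "x > 0"
  shows "((deriv ^^ n) (\<lambda>x. - h a k x) has_field_derivative uminus_h_deriv a k (Suc n) x) (at x)"
  using has_field_derivative_uminus_h_deriv[OF assms]
    DERIV_cong_ev[OF refl eventually_higher_deriv_uminus_h[OF assms] refl] by blast

theorem theorem2p8:
  fixes a :: real and k :: nat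
  assumes "a \<in> {0<..<1}" and "odd k"
  shows "strictly_completely_monotonic (\<lambda>x. - h a k x)"
  unfolding strictly_completely_monotonic_def
proof (intro conjI allI impI)
  fix n :: nat and x :: real
  assume x: "x > 0"
  have a: "a > 0" using assms by simp
  show "(deriv ^^ n) (\<lambda>x. - h a k x) differentiable (at x)"
    using has_field_derivative_higher_deriv_uminus_h[OF a x] real_differentiable_def by blast
  \<comment> \<open>Since \<open>k\<close> is odd, \<open>k + n\<close> is odd exactly when
    \<open>n\<close> is even. On the positive reals \<open>Polygamma\<close> strictly decreases for
    odd order and strictly increases for even order, so the difference has sign
    \<open>(- 1) ^ n\<close>.\<close>
  have "(- 1) ^ n * (Polygamma (k + n) x - Polygamma (k + n) (x + a)) > 0"
    using Polygamma_real_strict_mono[of x "x + a" "k + n"]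
      Polygamma_real_strict_antimono[of x "x + a" "k + n"] x a assms(2)
    by (cases "even n") (auto simp: odd_pos)
  moreover have "a * fact (k + n) / x ^ Suc (k + n) > 0"
    using a x by simp
  \<comment> \<open>In the power term the two factors \<open>(- 1) ^ n\<close> cancel.\<close>
  moreover have "(- 1) ^ n * (deriv ^^ n) (\<lambda>x. - h a k x) x =
      (- 1) ^ n * (Polygamma (k + n) x - Polygamma (k + n) (x + a)) + a * fact (k + n) / x ^ Suc (k + n)"
    by (cases "even n") (auto simp: higher_deriv_uminus_h[OF a x] uminus_h_deriv_def)
  ultimately show "(- 1) ^ n * (deriv ^^ n) (\<lambda>x. - h a k x) x > 0"
    by linarith
qed

end
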